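(* Let $\mu$ be an infinite cardinal and let $X$ be a $\mu$-sequential $T_2$ space such that for every free set $D \subset X$ we have $L(\overline{D}) \le \mu$, and moreover $\psi(X) \le 2^\mu$. Then $|X| \le 2^\mu$.
   Context: All spaces are assumed to be $T_1$. A space $X$ is $\mu$-sequential if for every non-closed set $A \subset X$ there is a (transfinite) sequence of length $\le \mu$ of points of $A$ that converges to a point of $X$ which is not in $A$ (a transfinite sequence $\langle a_\xi : \xi < \eta\rangle$ converges to $x$ if every neighborhood of $x$ contains all terms $a_\xi$ with $\xi \ge \xi_0$ for some $\xi_0 < \eta$). A transfinite sequence $\{x_\alpha : \alpha < \eta\} \subset X$ is a free sequence in $X$ if for every $\beta < \eta$ we have $\overline{\{x_\alpha : \alpha < \beta\}} \cap \overline{\{x_\alpha : \beta \le \alpha < \eta\}} = \emptyset$, closures being taken in $X$. A set $D \subset X$ is free if it has a well-ordering that turns it into a free sequence in $X$. $L(Y)$ is the Lindelöf degree of $Y$: the smallest infinite cardinal $\kappa$ such that every open cover of $Y$ has a subcover of size at most $\kappa$. $\psi(X)$ is the pseudocharacter of $X$: the smallest infinite cardinal $\kappa$ such that every singleton $\{x\}$, $x \in X$, is the intersection of at most $\kappa$ open subsets of $X$. *)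

theory Defs
  imports "HOL-Analysis.Analysis"
begin

unbundle cardinal_syntax

text \<open>
  Ordinals are well-order relations, compared by \<open>\<le>o\<close> (order embedding), and cardinals are
  relations satisfying \<^const>\<open>Card_order\<close> (initial ordinals). A transfinite sequence of
  length \<open>r\<close> is a function restricted to \<open>Field r\<close>. Every ordinal \<open>\<le>o \<mu>\<close> is isomorphic to a
  well-order on a subset of \<open>Field \<mu>\<close>, so in the definition of \<open>\<mu>\<close>-sequentiality the index
  relations may be taken on the type underlying \<open>\<mu>\<close>.
\<close>

definition seq_converges :: "'a topology \<Rightarrow> 'i rel \<Rightarrow> ('i \<Rightarrow> 'a) \<Rightarrow> 'a \<Rightarrow> bool" where
  "seq_converges X s a x \<longleftrightarrow>
     x \<in> topspace X \<and>
     (\<forall>U. openin X U \<and> x \<in> U \<longrightarrow>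
        (\<exists>\<xi>\<^sub>0 \<in> Field s. \<forall>\<xi> \<in> Field s. (\<xi>\<^sub>0, \<xi>) \<in> s \<longrightarrow> a \<xi> \<in> U))"

definition mu_sequential :: "'m rel \<Rightarrow> 'a topology \<Rightarrow> bool" where
  "mu_sequential \<mu> X \<longleftrightarrow>
     (\<forall>A. A \<subseteq> topspace X \<and> \<not> closedin X A \<longrightarrow>
        (\<exists>(s :: 'm rel) a x. Well_order s \<and> s \<le>o \<mu> \<and> a ` Field s \<subseteq> A \<and>
           x \<notin> A \<and> seq_converges X s a x))"

definition free_sequence :: "'a topology \<Rightarrow> 'i rel \<Rightarrow> ('i \<Rightarrow> 'a) \<Rightarrow> bool" where
  "free_sequence X r x \<longleftrightarrow>
     Well_order r \<and> x ` Field r \<subseteq> topspace X \<and>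
     (\<forall>\<beta> \<in> Field r. X closure_of (x ` underS r \<beta>) \<inter> X closure_of (x ` above r \<beta>) = {})"

definition free_set :: "'a topology \<Rightarrow> 'a set \<Rightarrow> bool" where
  "free_set X D \<longleftrightarrow> (\<exists>r. well_order_on D r \<and> free_sequence X r (\<lambda>d. d))"

text \<open>
  Cardinals are determined only up to \<open>=o\<close>, and the minimum is taken over cardinals on a fixed
  type, which therefore has to be large enough. For the two cardinal functions below,
  \<^typ>\<open>'a + nat\<close> suffices (for the pseudocharacter, provided that the space is \<open>T\<^sub>1\<close>); the lemmas
  \<open>lindelof_degree_ordLeq_iff\<close> and \<open>pseudocharacter_ordLeq_iff\<close> show that the values so
  obtained are the intended ones when compared with cardinals on any other type.
\<close>

definition least_infinite_cardinal :: "('b rel \<Rightarrow> bool) \<Rightarrow> 'b rel" where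
  "least_infinite_cardinal P =
     (SOME \<kappa>. Card_order \<kappa> \<and> cinfinite \<kappa> \<and> P \<kappa> \<and>
        (\<forall>\<kappa>'. Card_order \<kappa>' \<and> cinfinite \<kappa>' \<and> P \<kappa>' \<longrightarrow> \<kappa> \<le>o \<kappa>'))"

definition lindelof_degree :: "'a topology \<Rightarrow> ('a + nat) rel" where
  "lindelof_degree Y = least_infinite_cardinal (\<lambda>\<kappa>.
     \<forall>\<U>. (\<forall>U \<in> \<U>. openin Y U) \<and> \<Union>\<U> = topspace Y \<longrightarrow>
        (\<exists>\<V>. |\<V>| \<le>o \<kappa> \<and> \<V> \<subseteq> \<U> \<and> \<Union>\<V> = topspace Y))"

text \<open>The family \<open>\<U>\<close> is required to be nonempty because \<open>\<Inter>{}\<close> is the whole type rather than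
  the whole space.\<close>

definition pseudocharacter :: "'a topology \<Rightarrow> ('a + nat) rel" where
  "pseudocharacter X = least_infinite_cardinal (\<lambda>\<kappa>.
     \<forall>x \<in> topspace X. \<exists>\<U>. \<U> \<noteq> {} \<and> |\<U>| \<le>o \<kappa> \<and> (\<forall>U \<in> \<U>. openin X U) \<and> \<Inter>\<U> = {x})"

lemma least_infinite_cardinal:
  assumes "Card_order \<kappa>\<^sub>0" "cinfinite \<kappa>\<^sub>0" "P \<kappa>\<^sub>0"
  shows "Card_order (least_infinite_cardinal P)" "cinfinite (least_infinite_cardinal P)"
    and "P (least_infinite_cardinal P)"
    and "\<And>\<kappa>. Card_order \<kappa> \<Longrightarrow> cinfinite \<kappa> \<Longrightarrow> P \<kappa> \<Longrightarrow> least_infinite_cardinal P \<le>o \<kappa>"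
proof -
  let ?R = "{\<kappa>. Card_order \<kappa> \<and> cinfinite \<kappa> \<and> P \<kappa>}"
  have "?R \<noteq> {}" "\<forall>r \<in> ?R. Card_order r" using assms by auto
  then obtain \<kappa> where "\<kappa> \<in> ?R" "\<forall>\<kappa>' \<in> ?R. \<kappa> \<le>o \<kappa>'"
    using exists_minim_Card_order[of ?R] by blast
  then have "\<exists>\<kappa>. Card_order \<kappa> \<and> cinfinite \<kappa> \<and> P \<kappa> \<and>
        (\<forall>\<kappa>'. Card_order \<kappa>' \<and> cinfinite \<kappa>' \<and> P \<kappa>' \<longrightarrow> \<kappa> \<le>o \<kappa>')" by blast
  from someI_ex[OF this, folded least_infinite_cardinal_def]
  show "Card_order (least_infinite_cardinal P)" "cinfinite (least_infinite_cardinal P)"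
    and "P (least_infinite_cardinal P)"
    and "\<And>\<kappa>. Card_order \<kappa> \<Longrightarrow> cinfinite \<kappa> \<Longrightarrow> P \<kappa> \<Longrightarrow> least_infinite_cardinal P \<le>o \<kappa>"
    by auto
qed

lemma least_infinite_cardinal_ordLeq_iff:
  fixes P :: "'b rel \<Rightarrow> bool" and \<kappa> :: "'c rel"
  assumes inf: "infinite (UNIV :: 'b set)" and top: "P |UNIV :: 'b set|"
    and \<kappa>: "Card_order \<kappa>" "cinfinite \<kappa>"
    and PQ: "\<And>\<kappa>'. P \<kappa>' \<Longrightarrow> \<kappa>' \<le>o \<kappa> \<Longrightarrow> Q"
    and QP: "\<And>\<kappa>'. Q \<Longrightarrow> \<kappa> \<le>o \<kappa>' \<Longrightarrow> P \<kappa>'"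
  shows "least_infinite_cardinal P \<le>o \<kappa> \<longleftrightarrow> Q"
proof
  have *: "Card_order |UNIV :: 'b set|" "cinfinite |UNIV :: 'b set|"
    using inf by (simp_all add: cinfinite_def card_of_card_order_on Field_card_of)
  note least = least_infinite_cardinal[of "|UNIV :: 'b set|" P, OF * top]
  show Q if "least_infinite_cardinal P \<le>o \<kappa>" by (rule PQ[OF least(3) that])
  show "least_infinite_cardinal P \<le>o \<kappa>" if Q
  proof (cases "|Field \<kappa>| \<le>o |UNIV :: 'b set|")
    case True
    then obtain f :: "'c \<Rightarrow> 'b" where f: "inj_on f (Field \<kappa>)"
      using card_of_ordLeq[of "Field \<kappa>" "UNIV :: 'b set"] by auto
    have "bij_betw f (Field \<kappa>) (f ` Field \<kappa>)" using f by (rule inj_on_imp_bij_betw)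
    then have "|Field \<kappa>| =o |f ` Field \<kappa>|" by (rule card_of_ordIsoI)
    then have eq: "\<kappa> =o |f ` Field \<kappa>|"
      using ordIso_transitive[OF ordIso_symmetric[OF card_of_Field_ordIso[OF \<kappa>(1)]]] by simp
    then have "P |f ` Field \<kappa>|" by (rule QP[OF \<open>Q\<close> ordIso_imp_ordLeq])
    moreover have "cinfinite |f ` Field \<kappa>|"
      using \<kappa>(2) f by (simp add: cinfinite_def finite_image_iff Field_card_of)
    ultimately have "least_infinite_cardinal P \<le>o |f ` Field \<kappa>|"
      by (intro least(4) card_of_Card_order)
    then show ?thesis using ordLeq_ordIso_trans[OF _ ordIso_symmetric[OF eq]] by simp
  next
    case False
    then have "|UNIV :: 'b set| \<le>o |Field \<kappa>|"
      using ordLeq_total[OF card_of_Well_order card_of_Well_order] by blast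
    then have "|UNIV :: 'b set| \<le>o \<kappa>"
      by (rule ordLeq_ordIso_trans[OF _ card_of_Field_ordIso[OF \<kappa>(1)]])
    then show ?thesis by (rule ordLeq_transitive[OF least(4)[OF * top]])
  qed
qed

lemma lindelof_degree_ordLeq_iff:
  fixes Y :: "'a topology"
  assumes "Card_order \<kappa>" "cinfinite \<kappa>"
  shows "lindelof_degree Y \<le>o \<kappa> \<longleftrightarrow>
     (\<forall>\<U>. (\<forall>U \<in> \<U>. openin Y U) \<and> \<Union>\<U> = topspace Y \<longrightarrow>
        (\<exists>\<V>. |\<V>| \<le>o \<kappa> \<and> \<V> \<subseteq> \<U> \<and> \<Union>\<V> = topspace Y))"
  unfolding lindelof_degree_def
proof (rule least_infinite_cardinal_ordLeq_iff)
  show "infinite (UNIV :: ('a + nat) set)" by simp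
  show "\<forall>\<U>. (\<forall>U \<in> \<U>. openin Y U) \<and> \<Union>\<U> = topspace Y \<longrightarrow>
        (\<exists>\<V>. |\<V>| \<le>o |UNIV :: ('a + nat) set| \<and> \<V> \<subseteq> \<U> \<and> \<Union>\<V> = topspace Y)"
  proof (intro allI impI)
    fix \<U> assume \<U>: "(\<forall>U \<in> \<U>. openin Y U) \<and> \<Union>\<U> = topspace Y"
    then have "\<forall>y \<in> topspace Y. \<exists>U. U \<in> \<U> \<and> y \<in> U" by blast
    then obtain g where g: "\<And>y. y \<in> topspace Y \<Longrightarrow> g y \<in> \<U> \<and> y \<in> g y"
      using bchoice[of "topspace Y" "\<lambda>y U. U \<in> \<U> \<and> y \<in> U"] by blast
    have "|g ` topspace Y| \<le>o |topspace Y|" by (rule card_of_image)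
    also have "|topspace Y| \<le>o |UNIV :: ('a + nat) set|"
      by (rule card_of_ordLeqI[of Inl]) auto
    finally show "\<exists>\<V>. |\<V>| \<le>o |UNIV :: ('a + nat) set| \<and> \<V> \<subseteq> \<U> \<and> \<Union>\<V> = topspace Y"
      using g \<U> by (intro exI[of _ "g ` topspace Y"]) blast
  qed
qed (use assms in \<open>(assumption | meson ordLeq_transitive)+\<close>)

lemma pseudocharacter_ordLeq_iff:
  fixes X :: "'a topology"
  assumes "t1_space X" "Card_order \<kappa>" "cinfinite \<kappa>"
  shows "pseudocharacter X \<le>o \<kappa> \<longleftrightarrow>
     (\<forall>x \<in> topspace X. \<exists>\<U>. \<U> \<noteq> {} \<and> |\<U>| \<le>o \<kappa> \<and> (\<forall>U \<in> \<U>. openin X U) \<and> \<Inter>\<U> = {x})"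
  unfolding pseudocharacter_def
proof (rule least_infinite_cardinal_ordLeq_iff)
  show "infinite (UNIV :: ('a + nat) set)" by simp
  show "\<forall>x \<in> topspace X. \<exists>\<U>. \<U> \<noteq> {} \<and> |\<U>| \<le>o |UNIV :: ('a + nat) set| \<and>
          (\<forall>U \<in> \<U>. openin X U) \<and> \<Inter>\<U> = {x}"
  proof
    fix x assume x: "x \<in> topspace X"
    let ?\<U> = "(\<lambda>y. topspace X - (if y = x then {} else {y})) ` topspace X"
    have "|?\<U>| \<le>o |topspace X|" by (rule card_of_image)
    also have "|topspace X| \<le>o |UNIV :: ('a + nat) set|"
      by (rule card_of_ordLeqI[of Inl]) auto
    finally have "|?\<U>| \<le>o |UNIV :: ('a + nat) set|" .
    moreover have "\<forall>U \<in> ?\<U>. openin X U"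
      using assms(1) by (auto simp: t1_space_closedin_singleton)
    moreover have "\<Inter>?\<U> = {x}" using x by (auto split: if_splits)
    ultimately show "\<exists>\<U>. \<U> \<noteq> {} \<and> |\<U>| \<le>o |UNIV :: ('a + nat) set| \<and>
          (\<forall>U \<in> \<U>. openin X U) \<and> \<Inter>\<U> = {x}"
      using x by (intro exI[of _ ?\<U>]) blast
  qed
qed (use assms in \<open>(assumption | meson ordLeq_transitive)+\<close>)

end

theory Submission
  imports Defs
begin

text \<open>
  The space \<open>X\<close> has Lindelof degree at most \<open>\<mu>\<close>: otherwise a recursion produces a free sequence of
  length \<open>\<mu>\<^sup>+\<close>, whose closure cannot have Lindelof degree at most \<open>\<mu>\<close> in a \<open>\<mu>\<close>-sequential space.
  For every point fix at most \<open>2\<^sup>\<mu>\<close> neighbourhoods with intersection that point, and close off to a set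
  \<open>H\<close> of size at most \<open>2\<^sup>\<mu>\<close> that contains the limits of its sequences of length at most \<open>\<mu>\<close> (so it is
  closed) and meets the complement of the union of every family of at most \<open>\<mu>\<close> fixed
  neighbourhoods of its points that does not cover \<open>X\<close>. If some \<open>p\<close> were outside \<open>H\<close>, at most \<open>\<mu>\<close> of
  the fixed neighbourhoods avoiding \<open>p\<close> would cover \<open>H\<close>, so the union of such a family would miss a
  point of \<open>H\<close>, a contradiction. The set \<open>H\<close> plays the role of an elementary submodel.
\<close>

section \<open>Cardinal arithmetic\<close>

lemma Cinfinite_ctwo_cexp:
  assumes "Cinfinite \<mu>"
  shows "Cinfinite (ctwo ^c \<mu>)"
  by (rule Cinfinite_cexp[OF ordLeq_refl[OF Card_order_ctwo] assms])

lemma card_of_singleton_Cinfinite: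
  assumes "Cinfinite \<kappa>"
  shows "|{a}| \<le>o \<kappa>"
proof -
  have "|Field \<kappa>| =o \<kappa>" using assms card_of_Field_ordIso by blast
  moreover have "|{a}| \<le>o |Field \<kappa>|"
    using assms by (intro card_of_singl_ordLeq) (auto simp: cinfinite_def)
  ultimately show ?thesis using ordLeq_ordIso_trans by blast
qed

text \<open>A nonempty subset of size at most \<mu> is the image of a function from
  \<open>Field \<mu>\<close> to \<open>W\<close>, and (2^\<mu>)^\<mu> = 2^\<mu>. The empty set is
  added by hand, because \<open>Field \<mu>\<close> is nonempty.\<close>

lemma card_of_small_subsets:
  fixes \<mu> :: "'m rel" and W :: "'w set"
  assumes \<mu>: "Cinfinite \<mu>" and W: "|W| \<le>o ctwo ^c \<mu>"
  shows "|{V. V \<subseteq> W \<and> |V| \<le>o \<mu>}| \<le>o ctwo ^c \<mu>"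
proof -
  have "{V. V \<subseteq> W \<and> |V| \<le>o \<mu>} \<subseteq> insert {} ((\<lambda>g. g ` Field \<mu>) ` Func (Field \<mu>) W)"
  proof
    fix V assume "V \<in> {V. V \<subseteq> W \<and> |V| \<le>o \<mu>}"
    then have V: "V \<subseteq> W" "|V| \<le>o \<mu>" by auto
    show "V \<in> insert {} ((\<lambda>g. g ` Field \<mu>) ` Func (Field \<mu>) W)"
    proof (cases "V = {}")
      case False
      have "\<mu> =o |Field \<mu>|"
        using \<mu> by (intro ordIso_symmetric[OF card_of_Field_ordIso]) simp
      then have "|V| \<le>o |Field \<mu>|" by (rule ordLeq_ordIso_trans[OF V(2)])
      then have "\<exists>g. g ` Field \<mu> = V" by (simp only: card_of_ordLeq2[OF False])
      then obtain g where g: "g ` Field \<mu> = V" ..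
      define h where "h = (\<lambda>x. if x \<in> Field \<mu> then g x else undefined)"
      have "h \<in> Func (Field \<mu>) W" "h ` Field \<mu> = V"
        using g V(1) by (auto simp: h_def Func_def)
      then show ?thesis by blast
    qed simp
  qed
  then have "|{V. V \<subseteq> W \<and> |V| \<le>o \<mu>}| \<le>o |{{}} \<union> (\<lambda>g. g ` Field \<mu>) ` Func (Field \<mu>) W|"
    by (intro card_of_mono1) simp
  also have "|{{}} \<union> (\<lambda>g. g ` Field \<mu>) ` Func (Field \<mu>) W| \<le>o ctwo ^c \<mu>"
  proof (rule Un_Cinfinite_bound)
    show "Cinfinite (ctwo ^c \<mu>)" using \<mu> by (rule Cinfinite_ctwo_cexp)
    then show "|{{}}| \<le>o ctwo ^c \<mu>" by (rule card_of_singleton_Cinfinite)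
    have "|(\<lambda>g. g ` Field \<mu>) ` Func (Field \<mu>) W| \<le>o |Func (Field \<mu>) W|" by (rule card_of_image)
    also have "|Func (Field \<mu>) W| \<le>o (ctwo ^c \<mu>) ^c \<mu>"
      using cexp_mono1[OF W, of \<mu>] \<mu> by (simp add: cexp_def Field_card_of)
    also have "(ctwo ^c \<mu>) ^c \<mu> =o ctwo ^c \<mu>"
      using \<mu> by (intro cexp_cprod_ordLeq Card_order_ctwo Cinfinite_Cnotzero ordLeq_refl) auto
    finally show "|(\<lambda>g. g ` Field \<mu>) ` Func (Field \<mu>) W| \<le>o ctwo ^c \<mu>" .
  qed
  finally show ?thesis .
qed

lemma card_of_UN_small:
  assumes "Cinfinite \<kappa>" "|I| \<le>o \<kappa>" "\<And>i. i \<in> I \<Longrightarrow> |A i| \<le>o \<kappa>"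
  shows "|\<Union>i\<in>I. A i| \<le>o \<kappa>"
  using assms by (intro UNION_Cinfinite_bound) auto

lemma card_of_under_cardSuc:
  assumes \<mu>: "Cinfinite \<mu>"
  shows "|under (cardSuc \<mu>) \<alpha>| \<le>o \<mu>"
proof (cases "\<alpha> \<in> Field (cardSuc \<mu>)")
  case True
  have S: "Card_order (cardSuc \<mu>)" using \<mu> by (simp add: cardSuc_Card_order)
  then have "|underS (cardSuc \<mu>) \<alpha>| \<le>o \<mu>"
    using card_of_underS[OF S True] cardSuc_ordLeq_ordLess[OF _ card_of_Card_order] \<mu> by blast
  moreover have "|{\<alpha>}| \<le>o \<mu>"
    using \<mu> by (rule card_of_singleton_Cinfinite)
  ultimately have "|underS (cardSuc \<mu>) \<alpha> \<union> {\<alpha>}| \<le>o \<mu>"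
    using \<mu> by (intro Un_Cinfinite_bound) auto
  moreover have "under (cardSuc \<mu>) \<alpha> \<subseteq> underS (cardSuc \<mu>) \<alpha> \<union> {\<alpha>}"
    by (auto simp: under_def underS_def)
  ultimately show ?thesis using card_of_mono1 ordLeq_transitive by blast
next
  case False
  then have "under (cardSuc \<mu>) \<alpha> = {}" by (auto simp: under_def Field_def)
  then show ?thesis
    using ordLeq_transitive[OF card_of_empty card_of_singleton_Cinfinite[OF \<mu>]] by simp
qed

text \<open>Regularity of \<open>\<mu>\<^sup>+\<close>: it is a limit ordinal, so its proper initial
  segments form an increasing chain that covers it, and a small set lies inside one of them.\<close>

lemma small_subset_cardSuc_bounded:
  assumes \<mu>: "Cinfinite \<mu>" and I: "I \<subseteq> Field (cardSuc \<mu>)" "|I| \<le>o \<mu>"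
  obtains \<alpha> where "\<alpha> \<in> Field (cardSuc \<mu>)" "I \<subseteq> underS (cardSuc \<mu>) \<alpha>"
proof -
  let ?r = "cardSuc \<mu>"
  have r: "Cinfinite ?r" using \<mu> by (rule Cinfinite_cardSuc)
  then have r_order: "trans ?r" "antisym ?r"
    using \<mu> cardSuc_Well_order[of \<mu>] by (auto simp: order_on_defs)
  have "relChain ?r (underS ?r)"
    using underS_incr[OF r_order] by (auto simp: relChain_def)
  moreover have "I \<subseteq> (\<Union>i\<in>Field ?r. underS ?r i)"
    
  proof
    fix i assume "i \<in> I"
    then obtain j where "j \<in> Field ?r" "i \<noteq> j" "(i, j) \<in> ?r"
      using I(1) infinite_Card_order_limit[of ?r i] r by (auto simp: cinfinite_def)
    then show "i \<in> (\<Union>i\<in>Field ?r. underS ?r i)" by (auto simp: underS_def)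
  qed
  ultimately show ?thesis
    using that cardSuc_UNION[of \<mu> "underS ?r" I] \<mu> I(2) by (auto simp: cinfinite_def)
qed

section \<open>Recursion and closing off along \<open>\<mu>\<^sup>+\<close>\<close>

text \<open>A next value is demanded only when all earlier values were chosen correctly, so a
  construction may rely on properties of what has been built so far.\<close>

lemma wf_recursive_choice_cardSuc:
  assumes \<mu>: "Cinfinite \<mu>"
    and adm: "\<And>f g \<alpha> z. (\<And>\<beta>. \<beta> \<in> underS (cardSuc \<mu>) \<alpha> \<Longrightarrow> f \<beta> = g \<beta>) \<Longrightarrow> P f \<alpha> z = P g \<alpha> z"
    and ex: "\<And>\<alpha> f. \<alpha> \<in> Field (cardSuc \<mu>) \<Longrightarrow>
      (\<And>\<beta>. \<beta> \<in> underS (cardSuc \<mu>) \<alpha> \<Longrightarrow> P f \<beta> (f \<beta>)) \<Longrightarrow> \<exists>z. P f \<alpha> z"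
  obtains f where "\<And>\<alpha>. \<alpha> \<in> Field (cardSuc \<mu>) \<Longrightarrow> P f \<alpha> (f \<alpha>)"
proof -
  let ?r = "cardSuc \<mu>"
  have "Well_order ?r" using \<mu> cardSuc_Well_order by blast
  then have "wf (?r - Id)" by (simp add: well_order_on_def)
  then have "\<exists>f. \<forall>\<alpha>. \<alpha> \<in> Field ?r \<longrightarrow> P f \<alpha> (f \<alpha>)"
  proof (rule dependent_wf_choice)
    fix f g :: "'a set \<Rightarrow> 'b" and \<alpha> z
    assume "\<And>\<beta>. (\<beta>, \<alpha>) \<in> ?r - Id \<Longrightarrow> f \<beta> = g \<beta>"
    then show "(\<alpha> \<in> Field ?r \<longrightarrow> P f \<alpha> z) = (\<alpha> \<in> Field ?r \<longrightarrow> P g \<alpha> z)"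
      using adm[of \<alpha> f g z] by (auto simp: underS_def)
  next
    fix \<alpha> f assume *: "\<And>\<beta>. (\<beta>, \<alpha>) \<in> ?r - Id \<Longrightarrow> \<beta> \<in> Field ?r \<longrightarrow> P f \<beta> (f \<beta>)"
    show "\<exists>z. \<alpha> \<in> Field ?r \<longrightarrow> P f \<alpha> z"
    proof (cases "\<alpha> \<in> Field ?r")
      case True
      have "P f \<beta> (f \<beta>)" if "\<beta> \<in> underS ?r \<alpha>" for \<beta>
        using *[of \<beta>] that by (auto simp: underS_def Field_def)
      then show ?thesis using ex[OF True] by blast
    qed blast
  qed
  then show ?thesis using that by blast
qed

text \<open>Iterate \<open>\<mu>\<^sup>+\<close> times: every small subset of the union appears at some stage, because \<open>\<mu>\<^sup>+\<close>
  is regular.\<close>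

lemma closing_off:
  fixes G :: "'a set \<Rightarrow> 'a set"
  assumes \<mu>: "Cinfinite \<mu>"
    and G: "\<And>B. |B| \<le>o \<mu> \<Longrightarrow> |G B| \<le>o ctwo ^c \<mu>"
  obtains H where "|H| \<le>o ctwo ^c \<mu>" "\<And>B. B \<subseteq> H \<Longrightarrow> |B| \<le>o \<mu> \<Longrightarrow> G B \<subseteq> H"
proof -
  let ?r = "cardSuc \<mu>" and ?\<kappa> = "ctwo ^c \<mu>"
  have \<kappa>: "Cinfinite ?\<kappa>" using \<mu> by (rule Cinfinite_ctwo_cexp)
  have wo: "Well_order ?r" using \<mu> cardSuc_Well_order by blast
  then have r_order: "trans ?r" "antisym ?r" by (auto simp: order_on_defs)
  define step where "step Z = (\<Union>B\<in>{B. B \<subseteq> Z \<and> |B| \<le>o \<mu>}. G B)" for Z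
  have card_step: "|step Z| \<le>o ?\<kappa>" if "|Z| \<le>o ?\<kappa>" for Z
    unfolding step_def using \<kappa> card_of_small_subsets[OF \<mu> that] G
    by (intro card_of_UN_small) auto
  \<comment> \<open>The stage at the least index is an empty union; \<open>G {}\<close> supplies the
    first points at the next stage.\<close>
  obtain f where f: "\<And>\<alpha>. \<alpha> \<in> Field ?r \<Longrightarrow> f \<alpha> = (\<Union>\<beta>\<in>underS ?r \<alpha>. step (f \<beta>))"
  proof (rule wf_recursive_choice_cardSuc[OF \<mu>, of "\<lambda>f \<alpha> Z. Z = (\<Union>\<beta>\<in>underS ?r \<alpha>. step (f \<beta>))"])
    show "Z = (\<Union>\<beta>\<in>underS ?r \<alpha>. step (f \<beta>)) \<longleftrightarrow> Z = (\<Union>\<beta>\<in>underS ?r \<alpha>. step (g \<beta>))"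
      if "\<And>\<beta>. \<beta> \<in> underS ?r \<alpha> \<Longrightarrow> f \<beta> = g \<beta>" for f g \<alpha> Z
      using that by simp
  qed auto
  have "\<mu> <o ?\<kappa>" using \<mu> ordLess_ctwo_cexp by blast
  then have r_le: "?r \<le>o ?\<kappa>" using \<mu> \<kappa> by (intro cardSuc_least) auto
  have under_le: "|underS ?r \<alpha>| \<le>o ?\<kappa>" for \<alpha>
    by (rule ordLeq_transitive[OF card_of_mono1[OF underS_subset_under]
          ordLeq_transitive[OF card_of_under_cardSuc[OF \<mu>] ordLess_imp_ordLeq[OF \<open>\<mu> <o ?\<kappa>\<close>]]])
  have card_f: "|f \<alpha>| \<le>o ?\<kappa>" if "\<alpha> \<in> Field ?r" for \<alpha>
    using that
  proof (induction \<alpha> rule: wo_rel.well_order_induct[OF wo[folded wo_rel_def]])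
    case (1 \<alpha>)
    have "|step (f \<beta>)| \<le>o ?\<kappa>" if "\<beta> \<in> underS ?r \<alpha>" for \<beta>
      using 1 that by (intro card_step) (auto simp: underS_def Field_def)
    then show ?case unfolding f[OF 1(2)] using under_le \<kappa> by (intro card_of_UN_small) auto
  qed
  define H where "H = (\<Union>\<alpha>\<in>Field ?r. f \<alpha>)"
  show ?thesis
  proof (rule that[of H])
    show "|H| \<le>o ?\<kappa>" unfolding H_def
    proof (rule card_of_UN_small[OF \<kappa>])
      show "|Field ?r| \<le>o ?\<kappa>"
        using ordIso_ordLeq_trans[OF card_of_Field_ordIso[OF cardSuc_Card_order] r_le] \<mu> by blast
    qed (use card_f in auto)
  next
    fix B assume B: "B \<subseteq> H" "|B| \<le>o \<mu>"
    have "relChain ?r f"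
    proof (unfold relChain_def, intro allI impI)
      fix i j assume "(i, j) \<in> ?r"
      then have "i \<in> Field ?r" "j \<in> Field ?r" "underS ?r i \<subseteq> underS ?r j"
        using underS_incr[OF r_order] by (auto simp: Field_def)
      then show "f i \<subseteq> f j" using f by (metis (no_types, lifting) UN_mono order_refl)
    qed
    then obtain i where i: "i \<in> Field ?r" "B \<subseteq> f i"
      using cardSuc_UNION[of \<mu> f B] \<mu> B by (auto simp: cinfinite_def H_def)
    \<comment> \<open>Since \<open>\<mu>\<^sup>+\<close> has no last element, some stage comes after
      the one containing \<open>B\<close>, and it absorbs \<open>G B\<close>.\<close>
    have "Cinfinite ?r" using \<mu> by (rule Cinfinite_cardSuc)
    then obtain j where j: "j \<in> Field ?r" "i \<in> underS ?r j"
      using infinite_Card_order_limit[of ?r i] i by (auto simp: cinfinite_def underS_def)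
    have "G B \<subseteq> step (f i)" using i B(2) by (auto simp: step_def)
    also have "\<dots> \<subseteq> f j" using f[OF j(1)] j(2) by blast
    also have "\<dots> \<subseteq> H" using j by (auto simp: H_def)
    finally show "G B \<subseteq> H" .
  qed
qed

section \<open>Limits of short sequences\<close>

text \<open>\<open>S\<close> stands for the tails of a sequence in \<open>B\<close>. Of their linear
  order only pairwise intersection is kept: it makes limits unique in a Hausdorff space and, taken
  with T = T', makes every member nonempty.\<close>

definition small_limits :: "'m rel \<Rightarrow> 'a topology \<Rightarrow> 'a set \<Rightarrow> 'a set" where
  "small_limits \<mu> X B = {x \<in> topspace X. \<exists>S. S \<subseteq> Pow B \<and> |S| \<le>o \<mu> \<and> S \<noteq> {} \<and>
     (\<forall>T\<in>S. \<forall>T'\<in>S. T \<inter> T' \<noteq> {}) \<and> (\<forall>U. openin X U \<and> x \<in> U \<longrightarrow> (\<exists>T\<in>S. T \<subseteq> U))}"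

lemma small_limits_subset_closure_of: "small_limits \<mu> X B \<subseteq> X closure_of B"
proof
  fix x assume "x \<in> small_limits \<mu> X B"
  then obtain S where x: "x \<in> topspace X" and S: "S \<subseteq> Pow B" "\<forall>T\<in>S. \<forall>T'\<in>S. T \<inter> T' \<noteq> {}"
      "\<forall>U. openin X U \<and> x \<in> U \<longrightarrow> (\<exists>T\<in>S. T \<subseteq> U)"
    by (auto simp only: small_limits_def mem_Collect_eq)
  have "\<exists>y\<in>B. y \<in> U" if U: "x \<in> U" "openin X U" for U
  proof -
    obtain T where T: "T \<in> S" "T \<subseteq> U" using S(3) U by blast
    then have "T \<inter> T \<noteq> {}" using S(2) by blast
    then show ?thesis using T S(1) by blast
  qed
  then show "x \<in> X closure_of B" using x by (auto simp: in_closure_of)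
qed

text \<open>Coding a limit by the family of tails of the sequence, rather than by the sequence itself,
  avoids transporting index orders into \<open>Field \<mu>\<close>.\<close>

lemma card_of_small_limits:
  assumes \<mu>: "Cinfinite \<mu>" and X: "Hausdorff_space X" and B: "|B| \<le>o \<mu>"
  shows "|small_limits \<mu> X B| \<le>o ctwo ^c \<mu>"
proof -
  define Q where "Q S x \<longleftrightarrow> x \<in> topspace X \<and> (\<forall>T\<in>S. \<forall>T'\<in>S. T \<inter> T' \<noteq> {}) \<and>
    (\<forall>U. openin X U \<and> x \<in> U \<longrightarrow> (\<exists>T\<in>S. T \<subseteq> U))" for S x
  have unique: "x = y" if x: "Q S x" and y: "Q S y" for S x y
  proof (rule ccontr)
    assume "x \<noteq> y"
    moreover have "x \<in> topspace X" "y \<in> topspace X" using x y by (simp_all only: Q_def)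
    ultimately obtain U V where UV: "openin X U" "openin X V" "x \<in> U" "y \<in> V" "disjnt U V"
      using X unfolding Hausdorff_space_def by metis
    have tails: "\<forall>U. openin X U \<and> x \<in> U \<longrightarrow> (\<exists>T\<in>S. T \<subseteq> U)"
        "\<forall>U. openin X U \<and> y \<in> U \<longrightarrow> (\<exists>T\<in>S. T \<subseteq> U)" "\<forall>T\<in>S. \<forall>T'\<in>S. T \<inter> T' \<noteq> {}"
      using x y unfolding Q_def by blast+
    obtain T where T: "T \<in> S" "T \<subseteq> U" using tails(1) UV(1,3) by blast
    obtain T' where T': "T' \<in> S" "T' \<subseteq> V" using tails(2) UV(2,4) by blast
    have "T \<inter> T' \<noteq> {}" using tails(3) T(1) T'(1) by blast
    then show False using UV(5) T(2) T'(2) by (auto simp: disjnt_def)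
  qed
  \<comment> \<open>Each limit is recovered from its family \<open>S\<close>, so it suffices to
    count the families.\<close>
  have "small_limits \<mu> X B \<subseteq> (\<lambda>S. THE x. Q S x) ` {S. S \<subseteq> Pow B \<and> |S| \<le>o \<mu>}"
  proof
    fix x assume "x \<in> small_limits \<mu> X B"
    then obtain S where S: "S \<subseteq> Pow B" "|S| \<le>o \<mu>" "Q S x"
      by (auto simp only: small_limits_def Q_def mem_Collect_eq)
    have "(THE x. Q S x) = x" using S(3) by (rule the_equality) (rule unique[OF _ S(3)])
    then show "x \<in> (\<lambda>S. THE x. Q S x) ` {S. S \<subseteq> Pow B \<and> |S| \<le>o \<mu>}" using S by force
  qed
  then have "|small_limits \<mu> X B| \<le>o |(\<lambda>S. THE x. Q S x) ` {S. S \<subseteq> Pow B \<and> |S| \<le>o \<mu>}|"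
    by (rule card_of_mono1)
  also have "|(\<lambda>S. THE x. Q S x) ` {S. S \<subseteq> Pow B \<and> |S| \<le>o \<mu>}|
      \<le>o |{S. S \<subseteq> Pow B \<and> |S| \<le>o \<mu>}|" by (rule card_of_image)
  also have "|{S. S \<subseteq> Pow B \<and> |S| \<le>o \<mu>}| \<le>o ctwo ^c \<mu>"
  proof (rule card_of_small_subsets[OF \<mu>])
    show "|Pow B| \<le>o ctwo ^c \<mu>"
    \<comment> \<open>\<open>cexp_mono2'\<close> asks for a nonempty exponent.\<close>
    proof (cases "B = {}")
      case True
      then show ?thesis using card_of_singleton_Cinfinite[OF Cinfinite_ctwo_cexp[OF \<mu>]] by simp
    next
      case False
      have "|Pow B| =o ctwo ^c |B|"
        unfolding ctwo_def cexp_def Field_card_of by (rule card_of_Pow_Func)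
      also have "ctwo ^c |B| \<le>o ctwo ^c \<mu>"
        using B False by (intro cexp_mono2' Card_order_ctwo) (simp_all add: Field_card_of)
      finally show ?thesis .
    qed
  qed
  finally show ?thesis .
qed

text \<open>Otherwise sequentiality gives a sequence of length at most \<mu> in \<open>A\<close>
  with a limit outside \<open>A\<close>. Its terms form a small \<open>B\<close>, and its tails show
  that the limit belongs to \<open>small_limits \<mu> X B\<close>.\<close>

lemma mu_sequential_closedinI:
  fixes \<mu> :: "'m rel"
  assumes seq: "mu_sequential \<mu> X" and A: "A \<subseteq> topspace X"
    and lim: "\<And>B. B \<subseteq> A \<Longrightarrow> |B| \<le>o \<mu> \<Longrightarrow> small_limits \<mu> X B \<subseteq> A"
  shows "closedin X A"
proof (rule ccontr)
  assume "\<not> closedin X A"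
  then obtain s :: "'m rel" and a x where s: "Well_order s" "s \<le>o \<mu>" "a ` Field s \<subseteq> A"
      and x: "x \<notin> A" "seq_converges X s a x"
    using seq A unfolding mu_sequential_def by metis
  let ?S = "(\<lambda>\<xi>. a ` above s \<xi>) ` Field s"
  have "|Field s| \<le>o \<mu>"
    by (rule ordLeq_transitive[OF card_of_least[OF s(1)] s(2)])
  then have small: "|a ` Field s| \<le>o \<mu>" "|?S| \<le>o \<mu>"
    by (rule ordLeq_transitive[OF card_of_image])+
  have x_top: "x \<in> topspace X" using x(2) by (simp add: seq_converges_def)
  have tail: "\<exists>T\<in>?S. T \<subseteq> U" if "openin X U" "x \<in> U" for U
  proof -
    from that x(2) obtain \<xi> where \<xi>: "\<xi> \<in> Field s" "\<forall>\<eta>\<in>Field s. (\<xi>, \<eta>) \<in> s \<longrightarrow> a \<eta> \<in> U"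
      unfolding seq_converges_def by blast
    then have "a ` above s \<xi> \<subseteq> U" by (auto simp: above_def Field_def)
    then show ?thesis using \<xi>(1) by (intro bexI[OF _ imageI])
  qed
  have meet: "T \<inter> T' \<noteq> {}" if "T \<in> ?S" "T' \<in> ?S" for T T'
  proof -
    from that obtain \<xi> \<eta> where *: "T = a ` above s \<xi>" "T' = a ` above s \<eta>"
        "\<xi> \<in> Field s" "\<eta> \<in> Field s" by blast
    \<comment> \<open>The later of the two indices belongs to both tails.\<close>
    have "(\<xi>, \<xi>) \<in> s" "(\<eta>, \<eta>) \<in> s" "(\<xi>, \<eta>) \<in> s \<or> (\<eta>, \<xi>) \<in> s"
      using s(1) *(3,4) wo_rel.TOTALS[of s] by (auto simp: wo_rel_def)
    then have "above s \<xi> \<inter> above s \<eta> \<noteq> {}" unfolding above_def by blast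
    then show ?thesis using *(1,2) by blast
  qed
  have "?S \<subseteq> Pow (a ` Field s)" by (auto simp: above_def Field_def)
  moreover have "?S \<noteq> {}" using tail[OF openin_topspace x_top] by blast
  moreover have "\<forall>T\<in>?S. \<forall>T'\<in>?S. T \<inter> T' \<noteq> {}" by (intro ballI) (rule meet)
  moreover have "\<forall>U. openin X U \<and> x \<in> U \<longrightarrow> (\<exists>T\<in>?S. T \<subseteq> U)"
    by (intro allI impI, elim conjE) (rule tail)
  ultimately have "x \<in> small_limits \<mu> X (a ` Field s)"
    unfolding small_limits_def mem_Collect_eq using x_top small(2)
    by (intro conjI exI[of _ ?S])
  then show False using lim[OF s(3) small(1)] x(1) by blast
qed

section \<open>Free sequences\<close>

text \<open>The cover is traced on \<open>C\<close> to apply the Lindelof bound of the subspace, and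
  each selected trace is then lifted back to a member of the original cover.\<close>

lemma small_subcover_closed:
  assumes L: "lindelof_degree (subtopology X C) \<le>o \<mu>" and \<mu>: "Cinfinite \<mu>"
    and C: "C \<subseteq> topspace X" and \<O>: "\<And>U. U \<in> \<O> \<Longrightarrow> openin X U" "C \<subseteq> \<Union>\<O>"
  obtains \<V> where "\<V> \<subseteq> \<O>" "|\<V>| \<le>o \<mu>" "C \<subseteq> \<Union>\<V>"
proof -
  let ?\<U> = "(\<lambda>U. C \<inter> U) ` \<O>"
  have top: "topspace (subtopology X C) = C" using C by auto
  have "\<forall>U\<in>?\<U>. openin (subtopology X C) U"
    using \<O>(1) by (auto simp: openin_subtopology_Int2)
  moreover have "\<Union>?\<U> = C" using \<O>(2) by auto
  ultimately obtain \<W> where \<W>: "|\<W>| \<le>o \<mu>" "\<W> \<subseteq> ?\<U>" "\<Union>\<W> = C"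
    using L \<mu> lindelof_degree_ordLeq_iff[of \<mu> "subtopology X C"] unfolding top by metis
  define g where "g = inv_into \<O> (\<lambda>U. C \<inter> U)"
  have g: "g W \<in> \<O>" "C \<inter> g W = W" if "W \<in> \<W>" for W
    using \<W>(2) that inv_into_into[of W "\<lambda>U. C \<inter> U" \<O>] f_inv_into_f[of W "\<lambda>U. C \<inter> U" \<O>]
    unfolding g_def by blast+
  show ?thesis
  proof (rule that[of "g ` \<W>"])
    show "g ` \<W> \<subseteq> \<O>" using g by blast
    show "|g ` \<W>| \<le>o \<mu>" using card_of_image \<W>(1) by (rule ordLeq_transitive)
    show "C \<subseteq> \<Union>(g ` \<W>)" using g(2) \<W>(3) by blast
  qed
qed

text \<open>Freeness in the form that the recursion delivers: an open set that contains the closure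
  of an initial segment and misses the tail also misses the closure of the tail. The set
  \<open>A\<close> admits sequences that have been built only up to some stage.\<close>

definition separated_sequence :: "'a topology \<Rightarrow> 'i rel \<Rightarrow> ('i \<Rightarrow> 'a) \<Rightarrow> 'i set \<Rightarrow> bool" where
  "separated_sequence X r f A \<longleftrightarrow> f ` A \<subseteq> topspace X \<and>
     (\<forall>\<beta>\<in>A. \<exists>U. openin X U \<and> X closure_of (f ` (A \<inter> underS r \<beta>)) \<subseteq> U \<and>
        f ` (A \<inter> above r \<beta>) \<inter> U = {})"

lemma separated_sequence_closures_disjoint:
  assumes "separated_sequence X r f A" "\<beta> \<in> A"
  shows "X closure_of (f ` (A \<inter> underS r \<beta>)) \<inter> X closure_of (f ` (A \<inter> above r \<beta>)) = {}"
proof -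
  obtain U where "openin X U" "X closure_of (f ` (A \<inter> underS r \<beta>)) \<subseteq> U"
      "f ` (A \<inter> above r \<beta>) \<inter> U = {}"
    using assms unfolding separated_sequence_def by blast
  then show ?thesis using openin_Int_closure_of_eq_empty[of X U] by (metis disjoint_iff subsetD)
qed

text \<open>If \<beta> comes before \<gamma>, then \<open>f \<beta>\<close> lies in the segment
  below \<gamma> and \<open>f \<gamma>\<close> in the tail at \<gamma>, and these have disjoint
  closures.\<close>

lemma separated_sequence_inj_on:
  assumes r: "Well_order r" and A: "A \<subseteq> Field r" and f: "separated_sequence X r f A"
  shows "inj_on f A"
proof -
  have less: "f \<beta> \<noteq> f \<gamma>" if "\<beta> \<in> A" "\<gamma> \<in> A" "(\<beta>, \<gamma>) \<in> r" "\<beta> \<noteq> \<gamma>" for \<beta> \<gamma>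
  proof -
    have "f ` A \<subseteq> topspace X" using f by (simp add: separated_sequence_def)
    then have cl: "f ` (A \<inter> Z) \<subseteq> X closure_of (f ` (A \<inter> Z))" for Z
      by (intro closure_of_subset) blast
    have "(\<gamma>, \<gamma>) \<in> r" using r A that(2) by (auto simp: order_on_defs refl_on_def)
    then have "f \<beta> \<in> f ` (A \<inter> underS r \<gamma>)" "f \<gamma> \<in> f ` (A \<inter> above r \<gamma>)"
      using that by (auto simp: underS_def above_def)
    then show ?thesis
      using separated_sequence_closures_disjoint[OF f that(2)] cl by (metis disjoint_iff subsetD)
  qed
  show ?thesis
  proof (rule inj_onI, rule ccontr)
    fix \<beta> \<gamma> assume *: "\<beta> \<in> A" "\<gamma> \<in> A" "f \<beta> = f \<gamma>" "\<beta> \<noteq> \<gamma>"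
    then have "(\<beta>, \<gamma>) \<in> r \<or> (\<gamma>, \<beta>) \<in> r"
      using r A by (auto simp: order_on_defs total_on_def)
    then show False using less * by metis
  qed
qed

lemma separated_sequence_imp_free_set:
  assumes r: "Well_order r" and A: "A \<subseteq> Field r" and f: "separated_sequence X r f A"
  shows "free_set X (f ` A)"
proof -
  let ?q = "Restr r A"
  let ?p = "dir_image ?q f"
  have inj: "inj_on f A" using r A f by (rule separated_sequence_inj_on)
  have Fq: "Field ?q = A" using r A by (intro Refl_Field_Restr2) (auto simp: order_on_defs)
  have p: "Well_order ?p" "Field ?p = f ` A"
    using Well_order_dir_image[OF Well_order_Restr[OF r], of f A] inj Fq
    by (auto simp: dir_image_Field)
  have "underS ?p (f \<beta>) = f ` (A \<inter> underS r \<beta>)" "above ?p (f \<beta>) = f ` (A \<inter> above r \<beta>)"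
    if "\<beta> \<in> A" for \<beta>
    using that inj unfolding dir_image_def underS_def above_def inj_on_def by auto
  then have "\<forall>\<beta>\<in>Field ?p. X closure_of ((\<lambda>d. d) ` underS ?p \<beta>) \<inter>
      X closure_of ((\<lambda>d. d) ` above ?p \<beta>) = {}"
    using separated_sequence_closures_disjoint[OF f] p(2) by simp
  moreover have "(\<lambda>d. d) ` Field ?p \<subseteq> topspace X"
    using f p(2) by (simp add: separated_sequence_def)
  ultimately have "free_sequence X ?p (\<lambda>d. d)" using p(1) unfolding free_sequence_def by blast
  then show ?thesis unfolding free_set_def using p by metis
qed

text \<open>By sequentiality the closure of a free sequence of length \<open>\<mu>\<^sup>+\<close> is the union of the closures of
  its initial segments, so the complements of the closures of its tails form an increasing cover
  of it of length \<open>\<mu>\<^sup>+\<close> without a small subcover.\<close>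

lemma no_separated_sequence_cardSuc:
  assumes \<mu>: "Cinfinite \<mu>" and seq: "mu_sequential \<mu> X"
    and L: "\<And>D. free_set X D \<Longrightarrow> lindelof_degree (subtopology X (X closure_of D)) \<le>o \<mu>"
    and f: "separated_sequence X (cardSuc \<mu>) f (Field (cardSuc \<mu>))"
  shows False
proof -
  let ?r = "cardSuc \<mu>"
  let ?F = "Field ?r"
  have r: "Well_order ?r" using \<mu> cardSuc_Well_order by blast
  then have r_order: "trans ?r" "antisym ?r" by (auto simp: order_on_defs)
  have f_top: "f ` ?F \<subseteq> topspace X" using f by (simp add: separated_sequence_def)
  have Int: "?F \<inter> underS ?r \<alpha> = underS ?r \<alpha>" "?F \<inter> above ?r \<alpha> = above ?r \<alpha>" for \<alpha>
    by (auto simp: underS_def above_def Field_def)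
  note disj = separated_sequence_closures_disjoint[OF f, unfolded Int]
  define C where "C = (\<Union>\<alpha>\<in>?F. X closure_of (f ` underS ?r \<alpha>))"
  have C_top: "C \<subseteq> topspace X" unfolding C_def using closure_of_subset_topspace by fast
  have "closedin X C"
  proof (rule mu_sequential_closedinI[OF seq C_top])
    fix B assume B: "B \<subseteq> C" "|B| \<le>o \<mu>"
    \<comment> \<open>By regularity a small subset of this increasing union lies in a single
      closure, which then contains its limits.\<close>
    have "relChain ?r (\<lambda>\<alpha>. X closure_of (f ` underS ?r \<alpha>))"
      using underS_incr[OF r_order] unfolding relChain_def
      by (meson closure_of_mono image_mono)
    then obtain \<alpha> where \<alpha>: "\<alpha> \<in> ?F" "B \<subseteq> X closure_of (f ` underS ?r \<alpha>)"
      using cardSuc_UNION[of \<mu> "\<lambda>\<alpha>. X closure_of (f ` underS ?r \<alpha>)" B] \<mu> B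
      unfolding cinfinite_def C_def by blast
    have "small_limits \<mu> X B \<subseteq> X closure_of B" by (rule small_limits_subset_closure_of)
    also have "\<dots> \<subseteq> X closure_of (f ` underS ?r \<alpha>)"
      using \<alpha>(2) by (intro closure_of_minimal) auto
    finally show "small_limits \<mu> X B \<subseteq> C" using \<alpha>(1) unfolding C_def by blast
  qed
  have "f ` ?F \<subseteq> C"
  proof safe
    fix \<alpha> assume \<alpha>: "\<alpha> \<in> ?F"
    have "|{\<alpha>}| \<le>o \<mu>" using \<mu> by (rule card_of_singleton_Cinfinite)
    then obtain \<beta> where \<beta>: "\<beta> \<in> ?F" "{\<alpha>} \<subseteq> underS ?r \<beta>"
      using small_subset_cardSuc_bounded[OF \<mu>, of "{\<alpha>}"] \<alpha> by blast
    have "f ` underS ?r \<beta> \<subseteq> X closure_of (f ` underS ?r \<beta>)"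
      using f_top Int(1)[of \<beta>] by (intro closure_of_subset) blast
    then show "f \<alpha> \<in> C" using \<beta> unfolding C_def by blast
  qed
  then have cl_C: "X closure_of (f ` ?F) \<subseteq> C" using \<open>closedin X C\<close> by (rule closure_of_minimal)
  \<comment> \<open>The member at \<alpha> omits the tail from \<alpha> on but contains the closure
    of the segment before \<alpha>.\<close>
  let ?O = "\<lambda>\<alpha>. topspace X - X closure_of (f ` above ?r \<alpha>)"
  have C_cover: "C \<subseteq> \<Union>(?O ` ?F)"
  proof
    fix x assume x: "x \<in> C"
    then obtain \<alpha> where "\<alpha> \<in> ?F" "x \<in> X closure_of (f ` underS ?r \<alpha>)" unfolding C_def by blast
    then show "x \<in> \<Union>(?O ` ?F)" using disj[of \<alpha>] x C_top by blast
  qed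
  have "free_set X (f ` ?F)" using r _ f by (rule separated_sequence_imp_free_set) simp
  then have "lindelof_degree (subtopology X (X closure_of (f ` ?F))) \<le>o \<mu>" by (rule L)
  then obtain \<V> where \<V>: "\<V> \<subseteq> ?O ` ?F" "|\<V>| \<le>o \<mu>" "X closure_of (f ` ?F) \<subseteq> \<Union>\<V>"
  proof (rule small_subcover_closed[OF _ \<mu>])
    show "X closure_of (f ` ?F) \<subseteq> \<Union>(?O ` ?F)" using cl_C C_cover by (rule order_trans)
  qed (auto simp: closure_of_subset_topspace)
  define h where "h = inv_into ?F ?O"
  have h: "h V \<in> ?F" "?O (h V) = V" if "V \<in> \<V>" for V
    using \<V>(1) that inv_into_into[of V ?O ?F] f_inv_into_f[of V ?O ?F] unfolding h_def by blast+
  have "|h ` \<V>| \<le>o \<mu>" using card_of_image \<V>(2) by (rule ordLeq_transitive)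
  then obtain \<alpha> where \<alpha>: "\<alpha> \<in> ?F" "h ` \<V> \<subseteq> underS ?r \<alpha>"
    using small_subset_cardSuc_bounded[OF \<mu>, of "h ` \<V>"] h(1) by blast
  \<comment> \<open>The point \<open>f \<alpha>\<close> comes after every index \<open>h V\<close>,
    so every member of the subcover omits it, although it lies in the closure being covered.\<close>
  have f\<alpha>: "f \<alpha> \<in> X closure_of (f ` ?F)"
    using closure_of_subset[OF f_top] \<alpha>(1) by blast
  then obtain V where V: "V \<in> \<V>" "f \<alpha> \<in> V" using \<V>(3) by blast
  have "\<alpha> \<in> above ?r (h V)" using \<alpha>(2) V(1) by (auto simp: underS_def above_def)
  moreover have "f ` above ?r (h V) \<subseteq> X closure_of (f ` above ?r (h V))"
    using f_top Int(2)[of "h V"] by (intro closure_of_subset) blast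
  ultimately show False using h(2)[OF V(1)] V(2) by blast
qed

text \<open>Otherwise one chooses recursively, for each \<open>\<alpha> < \<mu>\<^sup>+\<close>, a point of \<open>H\<close> outside small subfamilies
  of the cover that cover the closures of the initial segments constructed so far.\<close>

lemma small_subcover_mu_sequential:
  fixes \<mu> :: "'m rel" and X :: "'a topology"
  assumes \<mu>: "Cinfinite \<mu>" and seq: "mu_sequential \<mu> X"
    and L: "\<And>D. free_set X D \<Longrightarrow> lindelof_degree (subtopology X (X closure_of D)) \<le>o \<mu>"
    and H: "closedin X H" and \<O>: "\<And>U. U \<in> \<O> \<Longrightarrow> openin X U" "H \<subseteq> \<Union>\<O>"
  shows "\<exists>\<V>. \<V> \<subseteq> \<O> \<and> |\<V>| \<le>o \<mu> \<and> H \<subseteq> \<Union>\<V>"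
proof (rule ccontr)
  assume no: "\<not> ?thesis"
  let ?r = "cardSuc \<mu>"
  let ?F = "Field ?r"
  have r: "Well_order ?r" using \<mu> cardSuc_Well_order by blast
  then have r_order: "trans ?r" "antisym ?r" by (auto simp: order_on_defs)
  define covers where "covers D \<V> \<longleftrightarrow> \<V> \<subseteq> \<O> \<and> |\<V>| \<le>o \<mu> \<and> X closure_of D \<subseteq> \<Union>\<V>" for D \<V>
  \<comment> \<open>The subcover is fixed as a function of the set alone, so the requirement at
    \<alpha> depends only on the values before \<alpha>.\<close>
  define K where "K D = (SOME \<V>. covers D \<V>)" for D
  have K: "covers D (K D)" if "D \<subseteq> H" "free_set X D" for D
  proof -
    have "X closure_of D \<subseteq> H" using that(1) H by (rule closure_of_minimal)
    then have "X closure_of D \<subseteq> \<Union>\<O>" using \<O>(2) by blast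
    then have "\<exists>\<V>. covers D \<V>" unfolding covers_def
      using small_subcover_closed[OF L[OF that(2)] \<mu> closure_of_subset_topspace \<O>(1)] by metis
    then show ?thesis unfolding K_def by (rule someI_ex)
  qed
  \<comment> \<open>\<open>under\<close> includes \<alpha> itself. Hence the subcover fixed for the
    segment before \<beta> is avoided by the whole tail at \<beta>, including the point
    \<open>f \<beta>\<close>.\<close>
  define P where "P f \<alpha> z \<longleftrightarrow> z \<in> H \<and> (\<forall>\<beta>\<in>under ?r \<alpha>. z \<notin> \<Union>(K (f ` underS ?r \<beta>)))"
    for f \<alpha> z
  \<comment> \<open>This is applied to proper initial segments during the recursion and to the whole
    index set at the end.\<close>
  have sep: "separated_sequence X ?r f A"
    if A: "A \<subseteq> ?F" "\<And>\<alpha>. \<alpha> \<in> A \<Longrightarrow> underS ?r \<alpha> \<subseteq> A"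
      and P: "\<And>\<alpha>. \<alpha> \<in> A \<Longrightarrow> P f \<alpha> (f \<alpha>)"
      and cov: "\<And>\<alpha>. \<alpha> \<in> A \<Longrightarrow> covers (f ` underS ?r \<alpha>) (K (f ` underS ?r \<alpha>))" for f A
    unfolding separated_sequence_def
  proof (intro conjI ballI exI)
    show "f ` A \<subseteq> topspace X" using P closedin_subset[OF H] unfolding P_def by blast
    fix \<beta> assume \<beta>: "\<beta> \<in> A"
    let ?U = "\<Union>(K (f ` underS ?r \<beta>))"
    have *: "K (f ` underS ?r \<beta>) \<subseteq> \<O>" "X closure_of (f ` underS ?r \<beta>) \<subseteq> ?U"
      using cov[OF \<beta>] unfolding covers_def by blast+
    show "openin X ?U" using *(1) \<O>(1) by (intro openin_Union) blast
    have "A \<inter> underS ?r \<beta> = underS ?r \<beta>" using A(2)[OF \<beta>] by blast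
    then show "X closure_of (f ` (A \<inter> underS ?r \<beta>)) \<subseteq> ?U" using *(2) by simp
    have "f \<gamma> \<notin> ?U" if "\<gamma> \<in> A" "\<gamma> \<in> above ?r \<beta>" for \<gamma>
      using P[OF that(1)] that(2) unfolding P_def above_def under_def by blast
    then show "f ` (A \<inter> above ?r \<beta>) \<inter> ?U = {}" by blast
  qed
  have underS_down: "underS ?r \<beta> \<subseteq> underS ?r \<alpha>" if "\<beta> \<in> underS ?r \<alpha>" for \<alpha> \<beta>
    using that by (intro underS_incr[OF r_order]) (simp add: underS_def)
  have underS_F: "underS ?r \<alpha> \<subseteq> ?F" for \<alpha> by (auto simp: underS_def Field_def)
  \<comment> \<open>A subcover is available only once the segment is known to be free, and freeness
    rests on the subcovers at earlier indices. Induction on \<alpha> resolves this circle.\<close>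
  have cov: "covers (f ` underS ?r \<alpha>) (K (f ` underS ?r \<alpha>))"
    if "\<alpha> \<in> ?F" "\<And>\<beta>. \<beta> \<in> underS ?r \<alpha> \<Longrightarrow> P f \<beta> (f \<beta>)" for f \<alpha>
    using that
  proof (induction \<alpha> rule: wo_rel.well_order_induct[OF r[folded wo_rel_def]])
    case (1 \<alpha>)
    have "separated_sequence X ?r f (underS ?r \<alpha>)"
    proof (rule sep[OF underS_F underS_down 1(3)])
      fix \<beta> assume \<beta>: "\<beta> \<in> underS ?r \<alpha>"
      show "covers (f ` underS ?r \<beta>) (K (f ` underS ?r \<beta>))"
      proof (rule 1(1)[rule_format])
        show "\<beta> \<noteq> \<alpha> \<and> (\<beta>, \<alpha>) \<in> ?r" using \<beta> by (simp add: underS_def)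
        show "\<beta> \<in> ?F" using \<beta> underS_F by blast
        show "P f \<gamma> (f \<gamma>)" if "\<gamma> \<in> underS ?r \<beta>" for \<gamma>
          using that underS_down[OF \<beta>] by (intro 1(3)) blast
      qed
    qed
    then have "free_set X (f ` underS ?r \<alpha>)"
      by (rule separated_sequence_imp_free_set[OF r underS_F])
    moreover have "f ` underS ?r \<alpha> \<subseteq> H" using 1(3) unfolding P_def by blast
    ultimately show ?case by (intro K)
  qed
  obtain f where f: "\<And>\<alpha>. \<alpha> \<in> ?F \<Longrightarrow> P f \<alpha> (f \<alpha>)"
  proof (rule wf_recursive_choice_cardSuc[OF \<mu>, of P])
    fix f g :: "'m set \<Rightarrow> 'a" and \<alpha> z
    assume *: "\<And>\<beta>. \<beta> \<in> underS ?r \<alpha> \<Longrightarrow> f \<beta> = g \<beta>"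
    have "f ` underS ?r \<beta> = g ` underS ?r \<beta>" if "\<beta> \<in> under ?r \<alpha>" for \<beta>
    proof (rule image_cong[OF refl])
      fix \<gamma> assume "\<gamma> \<in> underS ?r \<beta>"
      moreover have "underS ?r \<beta> \<subseteq> underS ?r \<alpha>"
        using that by (intro underS_incr[OF r_order]) (simp add: under_def)
      ultimately show "f \<gamma> = g \<gamma>" using * by blast
    qed
    then show "P f \<alpha> z = P g \<alpha> z" unfolding P_def by simp
  next
    fix \<alpha> f assume \<alpha>: "\<alpha> \<in> ?F" and P: "\<And>\<beta>. \<beta> \<in> underS ?r \<alpha> \<Longrightarrow> P f \<beta> (f \<beta>)"
    \<comment> \<open>At most \<mu> families of size at most \<mu> are involved up to \<alpha>, so
      by \<open>no\<close> their union leaves out a point of \<open>H\<close>.\<close>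
    let ?\<V> = "\<Union>\<beta>\<in>under ?r \<alpha>. K (f ` underS ?r \<beta>)"
    have c: "covers (f ` underS ?r \<beta>) (K (f ` underS ?r \<beta>))" if "\<beta> \<in> under ?r \<alpha>" for \<beta>
    proof (rule cov)
      show "\<beta> \<in> ?F" using that by (auto simp: under_def Field_def)
      have "underS ?r \<beta> \<subseteq> underS ?r \<alpha>"
        using that by (intro underS_incr[OF r_order]) (simp add: under_def)
      then show "P f \<gamma> (f \<gamma>)" if "\<gamma> \<in> underS ?r \<beta>" for \<gamma> using that by (intro P) blast
    qed
    have "?\<V> \<subseteq> \<O>" using c unfolding covers_def by blast
    moreover have "|?\<V>| \<le>o \<mu>"
      using \<mu> card_of_under_cardSuc[OF \<mu>] c unfolding covers_def by (intro card_of_UN_small) auto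
    ultimately have "\<not> H \<subseteq> \<Union>?\<V>" using no by blast
    then show "\<exists>z. P f \<alpha> z" unfolding P_def by blast
  qed (rule that)
  have "separated_sequence X ?r f ?F"
    using underS_F f by (intro sep cov) blast+
  with \<mu> seq L show False by (rule no_separated_sequence_cardSuc)
qed

section \<open>The bound on the size of the space\<close>

theorem theorem7:
  fixes \<mu> :: "'m rel" and X :: "'a topology"
  assumes "Card_order \<mu>" and "cinfinite \<mu>"
    and "mu_sequential \<mu> X" and "Hausdorff_space X"
    and "\<And>D. free_set X D \<Longrightarrow> lindelof_degree (subtopology X (X closure_of D)) \<le>o \<mu>"
    and "pseudocharacter X \<le>o ctwo ^c \<mu>"
  shows "|topspace X| \<le>o ctwo ^c \<mu>"
proof -
  have \<mu>: "Cinfinite \<mu>" using assms(1,2) by blast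
  then have \<kappa>: "Cinfinite (ctwo ^c \<mu>)" by (rule Cinfinite_ctwo_cexp)
  have "\<forall>x\<in>topspace X. \<exists>\<U>. \<U> \<noteq> {} \<and> |\<U>| \<le>o ctwo ^c \<mu> \<and> (\<forall>U\<in>\<U>. openin X U) \<and> \<Inter>\<U> = {x}"
    using assms(6) pseudocharacter_ordLeq_iff[OF Hausdorff_imp_t1_space[OF assms(4)]] \<kappa> by blast
  then obtain \<N> where \<N>: "\<And>x. x \<in> topspace X \<Longrightarrow> |\<N> x| \<le>o ctwo ^c \<mu> \<and>
      (\<forall>U\<in>\<N> x. openin X U) \<and> \<Inter>(\<N> x) = {x}"
    by metis
  \<comment> \<open>The value is arbitrary when the family covers the space. This may put points
    outside the space into the closed-off set, so \<open>H\<close> is later cut down to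
    \<open>topspace X\<close>.\<close>
  define pick where "pick \<V> = (SOME p. p \<in> topspace X - \<Union>\<V>)" for \<V>
  define nbhds where "nbhds B = (\<Union>x\<in>B \<inter> topspace X. \<N> x)" for B
  define G where "G B = small_limits \<mu> X B \<union> pick ` {\<V>. \<V> \<subseteq> nbhds B \<and> |\<V>| \<le>o \<mu>}" for B
  have card_G: "|G B| \<le>o ctwo ^c \<mu>" if B: "|B| \<le>o \<mu>" for B
  proof -
    have "\<mu> \<le>o ctwo ^c \<mu>" using assms(1) by (intro ordLess_imp_ordLeq ordLess_ctwo_cexp)
    with B have "|B| \<le>o ctwo ^c \<mu>" by (rule ordLeq_transitive)
    then have "|B \<inter> topspace X| \<le>o ctwo ^c \<mu>"
      by (rule ordLeq_transitive[OF card_of_mono1[OF Int_lower1]])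
    then have "|nbhds B| \<le>o ctwo ^c \<mu>"
      unfolding nbhds_def using \<kappa> \<N> by (intro card_of_UN_small) auto
    then have "|{\<V>. \<V> \<subseteq> nbhds B \<and> |\<V>| \<le>o \<mu>}| \<le>o ctwo ^c \<mu>"
      by (rule card_of_small_subsets[OF \<mu>])
    then have "|pick ` {\<V>. \<V> \<subseteq> nbhds B \<and> |\<V>| \<le>o \<mu>}| \<le>o ctwo ^c \<mu>"
      by (rule ordLeq_transitive[OF card_of_image])
    then show "|G B| \<le>o ctwo ^c \<mu>"
      unfolding G_def by (rule Un_Cinfinite_bound[OF card_of_small_limits[OF \<mu> assms(4) B] _ \<kappa>])
  qed
  obtain H\<^sub>0 where H\<^sub>0: "|H\<^sub>0| \<le>o ctwo ^c \<mu>" "\<And>B. B \<subseteq> H\<^sub>0 \<Longrightarrow> |B| \<le>o \<mu> \<Longrightarrow> G B \<subseteq> H\<^sub>0"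
    by (rule closing_off[OF \<mu>, of G]) (erule card_G, rule that)
  define H where "H = H\<^sub>0 \<inter> topspace X"
  have H_top: "H \<subseteq> topspace X" unfolding H_def by blast
  have G_H: "G B \<subseteq> H\<^sub>0" if "B \<subseteq> H" "|B| \<le>o \<mu>" for B
    using that unfolding H_def by (intro H\<^sub>0(2)) auto
  have "closedin X H"
  proof (rule mu_sequential_closedinI[OF assms(3) H_top])
    fix B assume B: "B \<subseteq> H" "|B| \<le>o \<mu>"
    have "small_limits \<mu> X B \<subseteq> topspace X" unfolding small_limits_def by blast
    then show "small_limits \<mu> X B \<subseteq> H" using G_H[OF B] unfolding G_def H_def by blast
  qed
  have "topspace X \<subseteq> H"
  proof (rule ccontr)
    assume "\<not> topspace X \<subseteq> H"
    then obtain p where p: "p \<in> topspace X" "p \<notin> H" by blast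
    have "\<exists>U. U \<in> \<N> x \<and> p \<notin> U" if "x \<in> H" for x
    proof -
      have "\<Inter>(\<N> x) = {x}" "p \<noteq> x" using \<N> that H_top p(2) by blast+
      then show ?thesis by blast
    qed
    then obtain u where u: "\<And>x. x \<in> H \<Longrightarrow> u x \<in> \<N> x \<and> p \<notin> u x" by metis
    have "x \<in> u x" if "x \<in> H" for x
    proof -
      have "\<Inter>(\<N> x) = {x}" using \<N> that H_top by blast
      then show ?thesis using u[OF that] by blast
    qed
    moreover have "openin X U" if "U \<in> u ` H" for U
      using that u \<N> H_top by blast
    moreover have "H \<subseteq> \<Union>(u ` H)" using calculation(1) by blast
    ultimately have "\<exists>\<V>. \<V> \<subseteq> u ` H \<and> |\<V>| \<le>o \<mu> \<and> H \<subseteq> \<Union>\<V>"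
      using small_subcover_mu_sequential[OF \<mu> assms(3) _ \<open>closedin X H\<close>, of "u ` H"] assms(5) by simp
    then obtain \<V> where \<V>: "\<V> \<subseteq> u ` H" "|\<V>| \<le>o \<mu>" "H \<subseteq> \<Union>\<V>" by blast
    \<comment> \<open>One centre is kept for each member of the subcover, so that the subcover
      consists of fixed neighbourhoods of points of a small subset of \<open>H\<close>.\<close>
    obtain B where B: "B \<subseteq> H" "inj_on u B" "\<V> = u ` B"
      using \<V>(1) unfolding subset_image_inj by blast
    have "|B| =o |\<V>|"
      using B(2,3) by (intro card_of_ordIsoI[of u]) (simp add: bij_betw_def)
    then have "|B| \<le>o \<mu>" using \<V>(2) by (rule ordIso_ordLeq_trans)
    moreover have "\<V> \<subseteq> nbhds B" unfolding nbhds_def B(3) using B(1) H_top u by blast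
    ultimately have "pick \<V> \<in> H\<^sub>0"
      using G_H[OF B(1)] \<V>(2) unfolding G_def by blast
    \<comment> \<open>The point \<open>p\<close> shows that the family does not cover the space, so
      \<open>pick \<V>\<close> really is a point outside its union. It belongs to \<open>H\<close>,
      which the family covers.\<close>
    moreover have "p \<in> topspace X - \<Union>\<V>" using p(1) u B(1,3) by blast
    then have "pick \<V> \<in> topspace X - \<Union>\<V>" unfolding pick_def by (rule someI)
    ultimately show False using \<V>(3) unfolding H_def by blast
  qed
  then have "topspace X \<subseteq> H\<^sub>0" unfolding H_def by blast
  then show ?thesis by (rule ordLeq_transitive[OF card_of_mono1 H\<^sub>0(1)])
qed

end
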